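(* Let $n,k\ge 1$ and let $X_1,\dots,X_k\in M_n(\mathbb{C})$ be Hermitian matrices that are linearly independent over $\mathbb{R}$. Let $D\in M_n(\mathbb{C})$ be an extreme density with respect to $\mathbf{X}=(X_1,\dots,X_k)$. Then $$\operatorname{rank}D\le\sqrt{k+1}.$$
   Context: A density (matrix) in $M_n(\mathbb{C})$ is a positive semidefinite matrix $D$ with $\operatorname{Tr}D=1$. For a density $D$ and a tuple $\mathbf{X}=(X_1,\dots,X_k)$ of Hermitian matrices in $M_n(\mathbb{C})$, the covariance matrix $\operatorname{Var}_D(\mathbf{X})$ is the $k\times k$ matrix with entries $$\operatorname{Var}_D(\mathbf{X})_{ij}=\operatorname{Tr}DX_iX_j-(\operatorname{Tr}DX_i)(\operatorname{Tr}DX_j),\qquad 1\le i,j\le k.$$ A density $D$ is called extreme with respect to $\mathbf{X}$ if whenever $D=\sum_l\lambda_lD_l$ and $\operatorname{Var}_D(\mathbf{X})=\sum_l\lambda_l\operatorname{Var}_{D_l}(\mathbf{X})$ for finitely many densities $D_l\in M_n(\mathbb{C})$ and scalars $0<\lambda_l<1$ with $\sum_l\lambda_l=1$, one has $D_l=D$ for every $l$. *)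

theory Defs
  imports "HOL-Analysis.Analysis"
begin

definition conj_transpose :: "complex^'n^'m \<Rightarrow> complex^'m^'n" where
  "conj_transpose A = (\<chi> i j. cnj (A $ j $ i))"

definition hermitian :: "complex^'n^'n \<Rightarrow> bool" where
  "hermitian A \<longleftrightarrow> conj_transpose A = A"

(* Taking the real part loses nothing, since the quadratic form of a Hermitian
   matrix is real-valued. *)
definition pos_semidef :: "complex^'n^'n \<Rightarrow> bool" where
  "pos_semidef A \<longleftrightarrow>
     hermitian A \<and> (\<forall>x. 0 \<le> Re (\<Sum>i\<in>UNIV. cnj (x $ i) * (A *v x) $ i))"

definition density :: "complex^'n^'n \<Rightarrow> bool" where
  "density D \<longleftrightarrow> pos_semidef D \<and> trace D = 1"

(* A k-tuple of matrices is a function on a finite index type of cardinality k.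
   The entries may be non-real, as the X i need not commute. *)
definition covariance ::
  "complex^'n^'n \<Rightarrow> ('k \<Rightarrow> complex^'n^'n) \<Rightarrow> complex^'k^'k" where
  "covariance D X =
     (\<chi> i j. trace (D ** X i ** X j) - trace (D ** X i) * trace (D ** X j))"

definition extreme_density ::
  "('k::finite \<Rightarrow> complex^'n^'n) \<Rightarrow> complex^'n^'n \<Rightarrow> bool" where
  "extreme_density X D \<longleftrightarrow> density D \<and>
     (\<forall>(m::nat) (c :: nat \<Rightarrow> real) (E :: nat \<Rightarrow> complex^'n^'n).
        (\<forall>l<m. density (E l)) \<and> (\<forall>l<m. 0 < c l \<and> c l < 1) \<and> (\<Sum>l<m. c l) = 1 \<and>
        D = (\<Sum>l<m. c l *\<^sub>R E l) \<and>
        covariance D X = (\<Sum>l<m. c l *\<^sub>R covariance (E l) X)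
        \<longrightarrow> (\<forall>l<m. E l = D))"

end

theory Submission
  imports Defs
begin

text \<open>
  If \<open>Y\<close> is Hermitian with \<open>Tr Y = 0\<close> and \<open>Tr (Y X\<^sub>i) = 0\<close> for all \<open>i\<close>, then the covariance is affine
  along \<open>D + t Y\<close>, so extremality of \<open>D\<close> forces \<open>Y = 0\<close> as soon as \<open>D \<plusminus> t Y\<close> is positive for some
  \<open>t > 0\<close>. This positivity holds for \<open>Y = D H D\<close> with \<open>H\<close> Hermitian. If the rows of \<open>D\<close> with indices
  in \<open>B\<close> form a basis of the row space, the matrices \<open>D H D\<close> with \<open>H\<close> supported on \<open>B \<times> B\<close> form a real
  space of dimension \<open>(rank D)\<^sup>2\<close>, on which the constraints are \<open>k + 1\<close> real linear equations; hence
  \<open>(rank D)\<^sup>2 \<le> k + 1\<close>.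
\<close>

section \<open>Quadratic forms and traces along a line of matrices\<close>

definition qform :: "complex^'n^'n \<Rightarrow> complex^'n \<Rightarrow> real" where
  "qform A x = Re (\<Sum>i\<in>UNIV. cnj (x $ i) * (A *v x) $ i)"

lemma pos_semidef_iff: "pos_semidef A \<longleftrightarrow> hermitian A \<and> (\<forall>x. 0 \<le> qform A x)"
  by (simp add: pos_semidef_def qform_def)

lemma hermitian_iff: "hermitian A \<longleftrightarrow> (\<forall>i j. cnj (A $ j $ i) = A $ i $ j)"
  by (simp add: hermitian_def conj_transpose_def vec_eq_iff)

lemma matrix_vector_mult_add_scaleR:
  fixes A B :: "complex^'n^'m"
  shows "(A + t *\<^sub>R B) *v x = A *v x + t *\<^sub>R (B *v x)"
  by (simp add: vec_eq_iff matrix_vector_mult_def sum.distrib scaleR_sum_right distrib_right)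

lemma matrix_mult_add_scaleR:
  fixes A B :: "complex^'n^'m" and C :: "complex^'p^'n"
  shows "(A + t *\<^sub>R B) ** C = A ** C + t *\<^sub>R (B ** C)"
  by (simp add: vec_eq_iff matrix_matrix_mult_def sum.distrib scaleR_sum_right distrib_right)

lemma trace_add_scaleR:
  fixes A B :: "complex^'n^'n"
  shows "trace (A + t *\<^sub>R B) = trace A + t *\<^sub>R trace B"
  by (simp add: trace_def sum.distrib scaleR_sum_right)

lemma qform_add_scaleR: "qform (A + t *\<^sub>R B) x = qform A x + t * qform B x"
  by (simp add: qform_def matrix_vector_mult_add_scaleR distrib_left sum.distrib
      sum_distrib_left flip: scaleR_sum_right)

text \<open>Conjugation transposes both factors, and cyclicity of the trace undoes this. Hence each
  constraint \<open>trace (Y ** X i) = 0\<close> costs one real equation instead of two.\<close>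

lemma trace_mult_hermitian_real:
  assumes "hermitian A" "hermitian B"
  shows "Im (trace (A ** B)) = 0"
proof -
  have "cnj (trace (A ** B)) = (\<Sum>i\<in>UNIV. \<Sum>k\<in>UNIV. A $ k $ i * B $ i $ k)"
    using assms by (simp add: trace_def matrix_matrix_mult_def hermitian_iff)
  also have "\<dots> = trace (A ** B)"
    by (subst sum.swap) (simp add: trace_def matrix_matrix_mult_def)
  finally show ?thesis
    by (simp add: complex_eq_iff)
qed

section \<open>Perturbing an extreme density\<close>

lemma density_perturb:
  assumes "density D" "hermitian Y" "trace Y = 0" "\<And>x. \<bar>t * qform Y x\<bar> \<le> qform D x"
  shows "density (D + t *\<^sub>R Y)"
proof -
  have "hermitian (D + t *\<^sub>R Y)"
    using assms(1,2) by (simp add: density_def pos_semidef_iff hermitian_iff)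
  moreover have "0 \<le> qform (D + t *\<^sub>R Y) x" for x
    using assms(4)[of x] by (simp add: qform_add_scaleR)
  ultimately show ?thesis
    using assms(1,3) by (simp add: density_def pos_semidef_iff trace_add_scaleR)
qed

text \<open>A term quadratic in \<open>t\<close> could come only from the product of traces, and
  that product does not change when \<open>Y\<close> is orthogonal to every
  \<open>X i\<close>.\<close>

lemma covariance_perturb:
  assumes "\<And>i. trace (Y ** X i) = 0"
  shows "covariance (D + t *\<^sub>R Y) X = covariance D X + t *\<^sub>R (\<chi> i j. trace (Y ** X i ** X j))"
  using assms by (simp add: covariance_def vec_eq_iff matrix_mult_add_scaleR trace_add_scaleR)

text \<open>Otherwise \<open>D\<close> would be the midpoint of the densities \<open>D + t Y\<close>
  and \<open>D - t Y\<close>, with the covariance averaging accordingly.\<close>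

lemma extreme_density_no_direction:
  fixes X :: "'k::finite \<Rightarrow> complex^'n^'n"
  assumes ext: "extreme_density X D" and herm: "hermitian Y"
    and tr: "trace Y = 0" "\<And>i. trace (Y ** X i) = 0"
    and bound: "\<And>x. \<bar>qform Y x\<bar> \<le> C * qform D x"
  shows "Y = 0"
proof -
  have D: "density D"
    using ext by (simp add: extreme_density_def)
  \<comment> \<open>The sign of \<open>C\<close> is unknown; the absolute value and the added 1 keep
    \<open>t\<close> positive, with \<open>t * C\<close> at most 1.\<close>
  define t where "t = 1 / (\<bar>C\<bar> + 1)"
  have t: "t > 0"
    by (simp add: t_def)
  have tY: "\<bar>t * qform Y x\<bar> \<le> qform D x" for x
  proof -
    have q: "0 \<le> qform D x"
      using D by (simp add: density_def pos_semidef_iff)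
    have "\<bar>qform Y x\<bar> \<le> (\<bar>C\<bar> + 1) * qform D x"
      using bound[of x] mult_right_mono[OF _ q, of C "\<bar>C\<bar> + 1"] by linarith
    then show ?thesis
      by (simp add: t_def abs_mult field_simps)
  qed
  define E where "E = (\<lambda>l::nat. D + (if l = 0 then t else - t) *\<^sub>R Y)"
  have two: "{..<2} = {0, 1::nat}"
    by auto
  have mid: "(1/2) *\<^sub>R (v + w) + (1/2) *\<^sub>R (v - w) = v" for v w :: "'v::real_vector"
    by (simp add: scaleR_add_right scaleR_diff_right flip: scaleR_add_left)
  have "\<forall>l<2. density (E l)"
    unfolding E_def using density_perturb[OF D herm tr(1)] tY by simp
  moreover have "D = (\<Sum>l<2. (1/2) *\<^sub>R E l)"
    by (simp add: two E_def mid)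
  moreover have "covariance D X = (\<Sum>l<2. (1/2) *\<^sub>R covariance (E l) X)"
    unfolding two E_def covariance_perturb[OF tr(2)] by (simp add: mid)
  ultimately have "\<forall>l<2. E l = D"
    by (intro ext[unfolded extreme_density_def, THEN conjunct2, THEN spec[of _ 2],
          THEN spec[of _ "\<lambda>_. 1/2"], THEN spec[of _ E], THEN mp] conjI) simp_all
  then have "E 0 = D"
    by simp
  then show ?thesis
    using t by (simp add: E_def)
qed

section \<open>Matrices dominated by a positive semidefinite matrix\<close>

text \<open>
  A weak Cauchy--Schwarz inequality: \<open>D\<^sub>b\<^sub>b + 1\<close> in place of \<open>D\<^sub>b\<^sub>b\<close> avoids the case \<open>D\<^sub>b\<^sub>b = 0\<close>.
\<close>
lemma pos_semidef_row_bound: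
  fixes D :: "complex^'n^'n"
  assumes "pos_semidef D"
  shows "(cmod ((D *v x) $ b))\<^sup>2 \<le> (Re (D $ b $ b) + 1) * qform D x"
proof -
  have herm: "cnj (D $ j $ i) = D $ i $ j" for i j
    using assms by (simp add: pos_semidef_iff hermitian_iff)
  have expand: "qform D (x + axis b w) =
      qform D x + 2 * Re (cnj w * (D *v x) $ b) + (cmod w)\<^sup>2 * Re (D $ b $ b)" for x w
  proof -
    have col: "(D *v axis b w) $ i = D $ i $ b * w" for i
      by (simp add: matrix_vector_mult_def axis_def if_distrib cong: if_cong)
    have ax: "(\<Sum>i\<in>UNIV. cnj (axis b w $ i) * f i) = cnj w * f b" for f
      by (simp add: axis_def if_distrib if_distribR cong: if_cong)
    \<comment> \<open>As \<open>D\<close> is Hermitian, the two cross terms are conjugate and add up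
      to twice a real part.\<close>
    have "(\<Sum>i\<in>UNIV. cnj (x $ i) * (D $ i $ b * w)) = cnj (cnj w * (D *v x) $ b)"
      by (simp add: matrix_vector_mult_def herm sum_distrib_left mult_ac)
    moreover have "qform D (x + axis b w) =
        Re ((\<Sum>i\<in>UNIV. cnj (x $ i) * (D *v x) $ i) + (\<Sum>i\<in>UNIV. cnj (x $ i) * (D $ i $ b * w))
          + cnj w * (D *v x) $ b + cnj w * (D $ b $ b * w))"
      by (simp add: qform_def matrix_vector_right_distrib distrib_left distrib_right sum.distrib col ax
          del: Re_sum)
    moreover have "cnj w * (D $ b $ b * w) = of_real ((cmod w)\<^sup>2) * D $ b $ b"
      by (simp only: complex_norm_square) (simp add: mult_ac)
    ultimately show ?thesis
      by (simp add: qform_def)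
  qed
  have pos: "0 \<le> qform D y" for y
    using assms by (simp add: pos_semidef_iff)
  define d where "d = Re (D $ b $ b)"
  define z where "z = (D *v x) $ b"
  have d: "0 \<le> d"
    using pos[of "axis b 1"] expand[of 0 1] by (simp add: qform_def d_def)
  define s where "s = 1 / (d + 1)"
  have s: "0 < s" "s * d \<le> 1"
    using d by (auto simp: s_def field_simps)
  \<comment> \<open>Positivity at \<open>x + axis b w\<close> with \<open>w = - s z\<close>. Since
    \<open>s * d \<le> 1\<close>, the quadratic term cancels at most half of the linear one.\<close>
  have "0 \<le> qform D x - 2 * s * (cmod z)\<^sup>2 + s * s * (cmod z)\<^sup>2 * d"
  proof -
    have "Re (cnj (- s *\<^sub>R z) * z) = - s * (cmod z)\<^sup>2"
      by (simp add: cmod_power2) (simp add: power2_eq_square algebra_simps)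
    moreover have "(cmod (- s *\<^sub>R z))\<^sup>2 = s * s * (cmod z)\<^sup>2"
      by (simp add: power2_eq_square)
    moreover have "0 \<le> qform D x + 2 * Re (cnj (- s *\<^sub>R z) * z) + (cmod (- s *\<^sub>R z))\<^sup>2 * d"
      using pos[of "x + axis b (- s *\<^sub>R z)"] unfolding expand z_def d_def .
    ultimately show ?thesis
      by (simp only:)
  qed
  also have "s * s * (cmod z)\<^sup>2 * d \<le> s * (cmod z)\<^sup>2"
    using mult_left_mono[OF s(2), of "s * (cmod z)\<^sup>2"] s(1) by (simp add: mult_ac)
  finally have "s * (cmod z)\<^sup>2 \<le> qform D x"
    by simp
  then show ?thesis
    using d by (simp add: s_def z_def d_def field_simps)
qed

text \<open>For \<open>H\<close> supported on \<open>B \<times> B\<close> and \<open>D\<close> Hermitian, this is \<open>D H D\<close>.\<close>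
definition sandwich :: "'n set \<Rightarrow> ('n \<Rightarrow> 'n \<Rightarrow> complex) \<Rightarrow> complex^'n^'n \<Rightarrow> complex^'n^'n" where
  "sandwich B H D = (\<chi> i j. \<Sum>b\<in>B. \<Sum>c\<in>B. H b c * cnj (D $ b $ i) * D $ c $ j)"

lemma hermitian_sandwich:
  assumes "\<And>b c. cnj (H c b) = H b c"
  shows "hermitian (sandwich B H D)"
  unfolding hermitian_iff
proof (intro allI)
  fix i j
  have "cnj (sandwich B H D $ j $ i) = (\<Sum>b\<in>B. \<Sum>c\<in>B. H c b * D $ b $ j * cnj (D $ c $ i))"
    by (simp add: sandwich_def assms)
  also have "\<dots> = sandwich B H D $ i $ j"
    by (subst sum.swap) (simp add: sandwich_def mult_ac)
  finally show "cnj (sandwich B H D $ j $ i) = sandwich B H D $ i $ j" .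
qed

text \<open>The form of \<open>D* H D\<close> at \<open>x\<close> is the form of \<open>H\<close> at
  \<open>D x\<close>.\<close>

lemma sandwich_vector:
  "(\<Sum>i\<in>UNIV. cnj (x $ i) * (sandwich B H D *v x) $ i) =
    (\<Sum>b\<in>B. \<Sum>c\<in>B. H b c * cnj ((D *v x) $ b) * (D *v x) $ c)"
proof -
  have "(\<Sum>b\<in>B. \<Sum>c\<in>B. H b c * cnj ((D *v x) $ b) * (D *v x) $ c) =
     (\<Sum>b\<in>B. \<Sum>c\<in>B. \<Sum>i\<in>UNIV. \<Sum>j\<in>UNIV. H b c * cnj (D $ b $ i) * cnj (x $ i) * D $ c $ j * x $ j)"
    by (simp add: matrix_vector_mult_def mult.assoc sum_product) (simp add: sum_distrib_left)
  also have "\<dots> =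
     (\<Sum>i\<in>UNIV. \<Sum>b\<in>B. \<Sum>c\<in>B. \<Sum>j\<in>UNIV. H b c * cnj (D $ b $ i) * cnj (x $ i) * D $ c $ j * x $ j)"
    by (simp only: sum.swap[where A = B and B = "UNIV"])
  also have "\<dots> =
     (\<Sum>i\<in>UNIV. \<Sum>j\<in>UNIV. \<Sum>b\<in>B. \<Sum>c\<in>B. H b c * cnj (D $ b $ i) * cnj (x $ i) * D $ c $ j * x $ j)"
    by (simp only: sum.swap[where A = B and B = "UNIV"])
  also have "\<dots> = (\<Sum>i\<in>UNIV. cnj (x $ i) * (sandwich B H D *v x) $ i)"
    by (simp add: matrix_vector_mult_def sandwich_def sum_distrib_left sum_distrib_right mult_ac)
  finally show ?thesis
    by simp
qed

text \<open>The form is a finite sum of products of two coordinates of \<open>D x\<close>, and the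
  square of each coordinate is bounded by a multiple of \<open>qform D x\<close>.\<close>

lemma sandwich_dominated:
  assumes "pos_semidef D"
  obtains C where "\<And>x. \<bar>qform (sandwich B H D) x\<bar> \<le> C * qform D x"
proof -
  define C where "C = (\<Sum>b\<in>B. \<Sum>c\<in>B. cmod (H b c) * ((Re (D $ b $ b) + 1) + (Re (D $ c $ c) + 1)))"
  have "\<bar>qform (sandwich B H D) x\<bar> \<le> C * qform D x" for x
  proof -
    define z where "z = D *v x"
    have "\<bar>qform (sandwich B H D) x\<bar> \<le> cmod (\<Sum>b\<in>B. \<Sum>c\<in>B. H b c * cnj (z $ b) * z $ c)"
      unfolding qform_def sandwich_vector z_def by (rule abs_Re_le_cmod)
    also have "\<dots> \<le> (\<Sum>b\<in>B. \<Sum>c\<in>B. cmod (H b c * cnj (z $ b) * z $ c))"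
      by (intro sum_norm_le order_refl)
    also have "\<dots> \<le> (\<Sum>b\<in>B. \<Sum>c\<in>B.
        cmod (H b c) * ((Re (D $ b $ b) + 1) + (Re (D $ c $ c) + 1)) * qform D x)"
    proof (intro sum_mono)
      fix b c
      have "cmod (z $ b) * cmod (z $ c) \<le> (cmod (z $ b))\<^sup>2 + (cmod (z $ c))\<^sup>2"
        using sum_squares_bound[of "cmod (z $ b)" "cmod (z $ c)"]
          mult_nonneg_nonneg[OF norm_ge_zero norm_ge_zero, of "z $ b" "z $ c"] by linarith
      also have "\<dots> \<le> ((Re (D $ b $ b) + 1) + (Re (D $ c $ c) + 1)) * qform D x"
        using pos_semidef_row_bound[OF assms, of x b] pos_semidef_row_bound[OF assms, of x c]
        by (simp add: z_def distrib_right)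
      finally show "cmod (H b c * cnj (z $ b) * z $ c)
          \<le> cmod (H b c) * ((Re (D $ b $ b) + 1) + (Re (D $ c $ c) + 1)) * qform D x"
        by (simp add: norm_mult mult.assoc mult_left_mono)
    qed
    finally show ?thesis
      by (simp add: C_def sum_distrib_right)
  qed
  then show ?thesis
    using that by blast
qed

text \<open>Independence of the rows in \<open>B\<close> is applied twice: it cancels the right
  factor \<open>D\<close>, then, after conjugation, the left one.\<close>

lemma sandwich_eq_0D:
  assumes indep: "\<And>w. (\<And>j. (\<Sum>b\<in>B. w b * D $ b $ j) = 0) \<Longrightarrow> \<forall>b\<in>B. w b = 0"
    and 0: "sandwich B H D = 0"
  shows "\<forall>b\<in>B. \<forall>c\<in>B. H b c = 0"
proof -
  have col: "(\<Sum>b\<in>B. H b c * cnj (D $ b $ i)) = 0" if "c \<in> B" for c i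
  proof -
    have "(\<Sum>c\<in>B. (\<Sum>b\<in>B. H b c * cnj (D $ b $ i)) * D $ c $ j) = sandwich B H D $ i $ j" for j
      by (simp add: sandwich_def sum_distrib_right) (rule sum.swap)
    then show ?thesis
      using indep[of "\<lambda>c. \<Sum>b\<in>B. H b c * cnj (D $ b $ i)"] that by (simp add: 0)
  qed
  have "cnj (H b c) = 0" if "b \<in> B" "c \<in> B" for b c
  proof -
    have "(\<Sum>b\<in>B. cnj (H b c) * D $ b $ i) = 0" for i
      using arg_cong[OF col[OF that(2), of i], of cnj] by simp
    then show ?thesis
      using indep[of "\<lambda>b. cnj (H b c)"] that(1) by simp
  qed
  then show ?thesis
    by simp
qed

section \<open>Row rank and linear relations\<close>

lemma rank_independent_rows:
  fixes D :: "'a::field^'n^'m"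
  obtains B where "card B = rank D"
    "\<And>w. (\<And>j. (\<Sum>b\<in>B. w b * D $ b $ j) = 0) \<Longrightarrow> \<forall>b\<in>B. w b = 0"
proof -
  obtain R where R: "R \<subseteq> rows D" "vec.independent R" "card R = vec.dim (rows D)"
    by (metis vec.basis_exists)
  have "rows D = range (($) D)"
    by (auto simp: rows_def row_def vec_eq_iff)
  \<comment> \<open>One index is chosen for each basis row, so repeated rows of \<open>D\<close> do
    not spoil the cardinality.\<close>
  then obtain B where inj: "inj_on (($) D) B" and B: "R = ($) D ` B"
    using R(1) by (metis subset_image_inj)
  have "card B = rank D"
    using R(3) inj by (simp add: B card_image row_rank_def_gen)
  moreover have "\<forall>b\<in>B. w b = 0" if w: "\<And>j. (\<Sum>b\<in>B. w b * D $ b $ j) = 0" for w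
  proof -
    define u where "u = (\<lambda>v. w (the_inv_into B (($) D) v))"
    have u: "u (D $ b) = w b" if "b \<in> B" for b
      using inj that by (simp add: u_def the_inv_into_f_f)
    have "(\<Sum>v\<in>R. u v *s v) = (\<Sum>b\<in>B. w b *s D $ b)"
      by (simp add: B sum.reindex[OF inj] u)
    also have "\<dots> = 0"
      using w by (simp add: vec_eq_iff)
    finally have "\<forall>v\<in>R. u v = 0"
      using R(2) vec.dependent_finite[of R] by (auto simp: B)
    then show ?thesis
      using u by (auto simp: B)
  qed
  ultimately show ?thesis
    using that by blast
qed

text \<open>Stated for families, since \<open>f\<close> may repeat values: a repetition is itself a
  relation, and without one the image has too many elements to be independent.\<close>

lemma exists_linear_relation:
  fixes f :: "'i \<Rightarrow> 'v::euclidean_space"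
  assumes "finite S" "card S > DIM('v)"
  obtains u where "(\<Sum>s\<in>S. u s *\<^sub>R f s) = 0" "\<exists>s\<in>S. u s \<noteq> 0"
proof (cases "inj_on f S")
  case True
  then have "dependent (f ` S)"
    using assms by (intro dependent_biggerset) (simp_all add: card_image)
  then obtain u where "\<exists>v\<in>f ` S. u v \<noteq> 0" "(\<Sum>v\<in>f ` S. u v *\<^sub>R v) = 0"
    using assms(1) by (auto simp: dependent_finite)
  then show ?thesis
    using that[of "u \<circ> f"] by (auto simp: sum.reindex[OF True])
next
  case False
  then obtain a b where ab: "a \<in> S" "b \<in> S" "f a = f b" "a \<noteq> b"
    by (auto simp: inj_on_def)
  define u :: "'i \<Rightarrow> real" where "u = (\<lambda>s. (if s = a then 1 else 0) - (if s = b then 1 else 0))"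
  have "(\<Sum>s\<in>S. (if s = c then 1 else 0) *\<^sub>R f s) = f c" if "c \<in> S" for c
  proof -
    have "(\<Sum>s\<in>S. (if s = c then 1 else 0) *\<^sub>R f s) = (\<Sum>s\<in>S. if s = c then f s else 0)"
      by (intro sum.cong) auto
    then show ?thesis
      using that assms(1) by simp
  qed
  then have "(\<Sum>s\<in>S. u s *\<^sub>R f s) = 0"
    using ab by (simp add: u_def scaleR_left_diff_distrib sum_subtractf)
  moreover have "u a \<noteq> 0"
    using ab by (simp add: u_def)
  ultimately show ?thesis
    using that ab by blast
qed

section \<open>Real parametrisation and dimension count\<close>

text \<open>Identifies real matrices with Hermitian ones, so that no basis of the latter is needed.\<close>
definition herm_of :: "('n \<times> 'n \<Rightarrow> real) \<Rightarrow> 'n \<Rightarrow> 'n \<Rightarrow> complex" where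
  "herm_of u b c = Complex (u (b, c) + u (c, b)) (u (b, c) - u (c, b))"

lemma cnj_herm_of: "cnj (herm_of u c b) = herm_of u b c"
  by (simp add: herm_of_def complex_eq_iff)

lemma herm_of_eq_0_iff: "herm_of u b c = 0 \<longleftrightarrow> u (b, c) = 0 \<and> u (c, b) = 0"
  by (auto simp: herm_of_def complex_eq_iff)

text \<open>Exchanging \<open>b\<close> and \<open>c\<close> in the terms with
  \<open>u (c, b)\<close> exhibits the matrix as a real combination of fixed matrices indexed by
  \<open>B \<times> B\<close>.\<close>

lemma sandwich_herm_of:
  fixes D :: "complex^'n^'n"
  shows "sandwich B (herm_of u) D = (\<Sum>(b, c)\<in>B \<times> B. u (b, c) *\<^sub>R
    (\<chi> i j. Complex 1 1 * cnj (D $ b $ i) * D $ c $ j + Complex 1 (-1) * cnj (D $ c $ i) * D $ b $ j))"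
proof -
  have "sandwich B (herm_of u) D $ i $ j =
      (\<Sum>b\<in>B. \<Sum>c\<in>B. u (b, c) *\<^sub>R (Complex 1 1 * cnj (D $ b $ i) * D $ c $ j)) +
      (\<Sum>b\<in>B. \<Sum>c\<in>B. u (b, c) *\<^sub>R (Complex 1 (-1) * cnj (D $ c $ i) * D $ b $ j))" for i j
  proof -
    have "herm_of u b c = u (b, c) *\<^sub>R Complex 1 1 + u (c, b) *\<^sub>R Complex 1 (-1)" for b c
      by (simp add: herm_of_def complex_eq_iff)
    then have "sandwich B (herm_of u) D $ i $ j =
        (\<Sum>b\<in>B. \<Sum>c\<in>B. u (b, c) *\<^sub>R (Complex 1 1 * cnj (D $ b $ i) * D $ c $ j)) +
        (\<Sum>b\<in>B. \<Sum>c\<in>B. u (c, b) *\<^sub>R (Complex 1 (-1) * cnj (D $ b $ i) * D $ c $ j))"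
      by (simp add: sandwich_def distrib_right sum.distrib)
    also have "(\<Sum>b\<in>B. \<Sum>c\<in>B. u (c, b) *\<^sub>R (Complex 1 (-1) * cnj (D $ b $ i) * D $ c $ j)) =
        (\<Sum>b\<in>B. \<Sum>c\<in>B. u (b, c) *\<^sub>R (Complex 1 (-1) * cnj (D $ c $ i) * D $ b $ j))"
      by (rule sum.swap)
    finally show ?thesis .
  qed
  then show ?thesis
    by (simp add: vec_eq_iff sum.distrib scaleR_add_right flip: sum.cartesian_product)
qed

theorem corollary1:
  fixes X :: "'k::finite \<Rightarrow> complex^'n^'n"
    and D :: "complex^'n^'n"
  assumes "\<And>i. hermitian (X i)"
    and "inj X" and "independent (range X)"
    and "extreme_density X D"
  shows "real (rank D) \<le> sqrt (real (CARD('k)) + 1)"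
proof -
  obtain B where B: "card B = rank D"
    and indep: "\<And>w. (\<And>j. (\<Sum>b\<in>B. w b * D $ b $ j) = 0) \<Longrightarrow> \<forall>b\<in>B. w b = 0"
    using rank_independent_rows[of D] by blast
  have "(rank D)\<^sup>2 \<le> CARD('k) + 1"
  proof (rule ccontr)
    define M where "M = (\<lambda>(b, c). (\<chi> i j. Complex 1 1 * cnj (D $ b $ i) * D $ c $ j
      + Complex 1 (-1) * cnj (D $ c $ i) * D $ b $ j) :: complex^'n^'n)"
    \<comment> \<open>Only real parts are recorded, so the target has real dimension
      \<open>k + 1\<close>; the imaginary parts vanish at the Hermitian matrix
      \<open>Y\<close>.\<close>
    define F :: "complex^'n^'n \<Rightarrow> (real^'k) \<times> real"
      where "F = (\<lambda>A. (\<chi> k. Re (trace (A ** X k)), Re (trace A)))"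
    have affine: "F (A + t *\<^sub>R B) = F A + t *\<^sub>R F B" for A B t
      by (simp add: F_def vec_eq_iff matrix_mult_add_scaleR trace_add_scaleR)
    \<comment> \<open>Additivity is the case \<open>t = 1\<close> and homogeneity the case
      \<open>A = 0\<close>, where \<open>F 0 = 0\<close> follows from
      \<open>F 0 = F 0 + F 0\<close>.\<close>
    have lin: "linear F"
      using affine[of _ 1] affine[of 0] affine[of 0 1 0] by (intro linearI) simp_all
    assume "\<not> (rank D)\<^sup>2 \<le> CARD('k) + 1"
    then have "card (B \<times> B) > DIM((real^'k) \<times> real)"
      by (simp add: B card_cartesian_product power2_eq_square)
    then obtain u where u0: "(\<Sum>s\<in>B \<times> B. u s *\<^sub>R F (M s)) = 0" and u: "\<exists>s\<in>B \<times> B. u s \<noteq> 0"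
      using exists_linear_relation[of "B \<times> B" "\<lambda>s. F (M s)"] by auto
    define Y where "Y = sandwich B (herm_of u) D"
    have "Y = (\<Sum>s\<in>B \<times> B. u s *\<^sub>R M s)"
      unfolding Y_def sandwich_herm_of M_def by (intro sum.cong) auto
    then have FY: "F Y = 0"
      using u0 lin by (simp add: linear_sum linear_cmul)
    have herm: "hermitian Y"
      unfolding Y_def by (intro hermitian_sandwich cnj_herm_of)
    have "trace (Y ** X i) = 0" for i
      using FY trace_mult_hermitian_real[OF herm assms(1)]
      by (simp add: F_def complex_eq_iff vec_eq_iff zero_prod_def)
    moreover have "trace Y = 0"
    proof -
      \<comment> \<open>The trace of \<open>Y\<close> is treated as that of the product of
        \<open>Y\<close> with the identity.\<close>
      have "hermitian (mat 1 :: complex^'n^'n)"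
        by (simp add: hermitian_iff mat_def)
      then show ?thesis
        using FY trace_mult_hermitian_real[OF herm]
        by (metis F_def complex_eq_iff matrix_mul_rid prod.inject zero_complex.sel zero_prod_def)
    qed
    moreover obtain C where "\<And>x. \<bar>qform Y x\<bar> \<le> C * qform D x"
      using sandwich_dominated assms(4) unfolding Y_def extreme_density_def density_def by metis
    ultimately have "Y = 0"
      using extreme_density_no_direction[OF assms(4) herm] by blast
    then have "\<forall>b\<in>B. \<forall>c\<in>B. herm_of u b c = 0"
      unfolding Y_def by (intro sandwich_eq_0D[OF indep])
    then show False
      using u by (auto simp: herm_of_eq_0_iff)
  qed
  then have "(real (rank D))\<^sup>2 \<le> real CARD('k) + 1"
    by (simp flip: of_nat_power of_nat_Suc)
  then show ?thesis
    by (rule real_le_rsqrt)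
qed

end
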